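(* Given real constants $B>0$, $-1\le C<1$ and $\varepsilon\le C$, let $$M=\left(\tfrac12(1-C)B\right)^{\frac1{1-\varepsilon}}>0.$$ Suppose the function $u:(-1,1)\to\mathbb{R}$ satisfies: (i) $u\in\mathcal{C}^2([0,1))$; (ii) for $0<t<1$, $$u(t)u''(t)\ge B|u(t)|^{1+\varepsilon}+C(u'(t))^2.$$ If $u(0)>0$ and $u'(0)\ge0$, then $\displaystyle\sup_{0\le y<1}u(y)>M$. *)

theory Defs
  imports "HOL-Analysis.Analysis"
begin

text \<open>
  Conventions. Membership of \<open>u\<close> in the class C^2 on the half-open interval
  \<open>{0..<1}\<close> is stated by giving the first and second derivatives \<open>u'\<close>, \<open>u''\<close>
  relative to \<open>{0..<1}\<close> (so one-sided at 0 and two-sided elsewhere, and uniquely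
  determined there) and continuity of \<open>u''\<close>. Values of \<open>u\<close> outside \<open>{0..<1}\<close> are
  irrelevant. The supremum is taken in \<^typ>\<open>ereal\<close>, since \<open>u\<close> may be unbounded.

  The exponent \<open>1 + \<epsilon>\<close> may be zero or negative. As \<open>0 powr a = 0\<close> for all \<open>a\<close>,
  at a zero of \<open>u\<close> the differential inequality is then implied by its reading under
  any convention assigning a nonnegative or infinite value to that power.
\<close>

end

theory Submission
  imports Defs
begin

text \<open>
  As long as \<open>u > 0\<close>, the function \<open>w = u powr (1 - C)\<close> satisfies
  \<open>w'' = (1 - C) * u powr (- C - 1) * (u * u'' - C * u'\<^sup>2) \<ge> (1 - C) * B * u powr (\<epsilon> - C)\<close>.
  If \<open>u \<le> M\<close> throughout, then \<open>\<epsilon> \<le> C\<close> bounds the right-hand side below by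
  \<open>(1 - C) * B * M powr (\<epsilon> - C) = 2 * M powr (1 - C)\<close>. Integrating twice from \<open>w' 0 \<ge> 0\<close>
  gives \<open>w t \<ge> w 0 + M powr (1 - C) * t\<^sup>2\<close>, so \<open>u\<close> never reaches zero, and letting
  \<open>t \<rightarrow> 1\<close> contradicts \<open>w \<le> M powr (1 - C)\<close>.
\<close>

text \<open>The functions \<open>w' x - k * x\<close> and \<open>w x - k * x\<^sup>2 / 2\<close> are
  nondecreasing in turn. Derivatives are required only in the open interval and continuity covers
  the endpoints, which suits a \<open>u\<close> that is merely one-sidedly differentiable at
  0.\<close>

lemma quadratic_lower_bound:
  fixes w w' w'' :: "real \<Rightarrow> real"
  assumes "0 \<le> t"
    and cont: "continuous_on {0..t} w" "continuous_on {0..t} w'"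
    and w': "\<And>x. 0 < x \<Longrightarrow> x < t \<Longrightarrow> (w has_real_derivative w' x) (at x)"
    and w'': "\<And>x. 0 < x \<Longrightarrow> x < t \<Longrightarrow> (w' has_real_derivative w'' x) (at x)"
    and bound: "\<And>x. 0 < x \<Longrightarrow> x < t \<Longrightarrow> k \<le> w'' x"
    and init: "0 \<le> w' 0"
  shows "w 0 + k * t\<^sup>2 / 2 \<le> w t"
proof -
  have slope: "k * x \<le> w' x" if "0 \<le> x" "x \<le> t" for x
  proof -
    have "w' 0 - k * 0 \<le> w' x - k * x"
    proof (rule DERIV_nonneg_imp_increasing_open[OF \<open>0 \<le> x\<close>])
      fix y assume "0 < y" "y < x"
      then show "\<exists>d. ((\<lambda>y. w' y - k * y) has_real_derivative d) (at y) \<and> 0 \<le> d"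
        using that bound[of y]
        by (intro exI[of _ "w'' y - k"]) (auto intro!: derivative_eq_intros w'')
    next
      show "continuous_on {0..x} (\<lambda>y. w' y - k * y)"
        using that by (intro continuous_intros continuous_on_subset[OF cont(2)]) auto
    qed
    then show ?thesis using init by simp
  qed
  have "w 0 - k * 0\<^sup>2 / 2 \<le> w t - k * t\<^sup>2 / 2"
  proof (rule DERIV_nonneg_imp_increasing_open[OF \<open>0 \<le> t\<close>])
    fix y assume "0 < y" "y < t"
    then show "\<exists>d. ((\<lambda>y. w y - k * y\<^sup>2 / 2) has_real_derivative d) (at y) \<and> 0 \<le> d"
      using slope[of y]
      by (intro exI[of _ "w' y - k * y"]) (auto intro!: derivative_eq_intros w')
  next
    show "continuous_on {0..t} (\<lambda>y. w y - k * y\<^sup>2 / 2)"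
      by (intro continuous_intros cont) auto
  qed
  then show ?thesis by simp
qed

text \<open>This applies the previous lemma to \<open>u powr (1 - C)\<close>. It is stated on a
  subinterval where \<open>u\<close> is positive, because positivity on all of
  \<open>{0..<1}\<close> is itself deduced from this bound.\<close>

lemma powr_quadratic_lower_bound:
  fixes u u' u'' :: "real \<Rightarrow> real"
  assumes B: "0 \<le> B" and C: "C < 1" and eps: "\<epsilon> \<le> C" and t: "0 \<le> t"
    and pos: "\<And>x. 0 \<le> x \<Longrightarrow> x \<le> t \<Longrightarrow> 0 < u x"
    and le_M: "\<And>x. 0 \<le> x \<Longrightarrow> x \<le> t \<Longrightarrow> u x \<le> M"
    and cont: "continuous_on {0..t} u" "continuous_on {0..t} u'"
    and u': "\<And>x. 0 < x \<Longrightarrow> x < t \<Longrightarrow> (u has_real_derivative u' x) (at x)"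
    and u'': "\<And>x. 0 < x \<Longrightarrow> x < t \<Longrightarrow> (u' has_real_derivative u'' x) (at x)"
    and ineq: "\<And>x. 0 < x \<Longrightarrow> x < t \<Longrightarrow>
      B * \<bar>u x\<bar> powr (1 + \<epsilon>) + C * (u' x)\<^sup>2 \<le> u x * u'' x"
    and init: "0 \<le> u' 0"
  shows "u 0 powr (1 - C) + (1 - C) * B * M powr (\<epsilon> - C) * t\<^sup>2 / 2 \<le> u t powr (1 - C)"
proof (rule quadratic_lower_bound[OF t])
  let ?w' = "\<lambda>x. (1 - C) * u x powr (- C) * u' x"
  let ?w'' = "\<lambda>x. (1 - C) * u x powr (- C - 1) * (u x * u'' x - C * (u' x)\<^sup>2)"
  have nz: "\<forall>x\<in>{0..t}. u x \<noteq> 0"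
    using pos by fastforce
  show "continuous_on {0..t} (\<lambda>x. u x powr (1 - C))"
    using nz by (intro continuous_intros cont) auto
  show "continuous_on {0..t} ?w'"
    using nz by (intro continuous_intros cont) auto
  show "0 \<le> ?w' 0"
    using C init by simp
  fix x assume x: "0 < x" "x < t"
  then have ux: "0 < u x" "u x \<le> M"
    using pos le_M by simp_all
  show "((\<lambda>x. u x powr (1 - C)) has_real_derivative ?w' x) (at x)"
    using ux by (auto intro!: derivative_eq_intros u' x)
  \<comment> \<open>This puts both terms of the product rule over the common factor
    \<open>u x powr (- C - 1)\<close>.\<close>
  have split: "u x powr (- C) = u x powr (- C - 1) * u x"
    using ux by (simp add: powr_diff)
  show "(?w' has_real_derivative ?w'' x) (at x)"
    by (rule derivative_eq_intros u' u'' x ux refl)+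
      (use split in \<open>simp add: algebra_simps power2_eq_square\<close>)
  \<comment> \<open>Since \<open>\<epsilon> - C\<close> is nonpositive, the power is antitone in its
    base, so the upper bound \<open>M\<close> on \<open>u\<close> yields a lower bound.\<close>
  have "(1 - C) * B * M powr (\<epsilon> - C) \<le> (1 - C) * B * u x powr (\<epsilon> - C)"
    using ux eps B C by (intro mult_left_mono powr_mono2') auto
  also have "\<dots> = (1 - C) * u x powr (- C - 1) * (B * u x powr (1 + \<epsilon>))"
    by (simp add: powr_add[symmetric])
  also have "\<dots> \<le> ?w'' x"
    using ineq[OF x] ux C by (intro mult_left_mono) auto
  finally show "(1 - C) * B * M powr (\<epsilon> - C) \<le> ?w'' x" .
qed

text \<open>The zero set is compact and, by the intermediate value theorem, nonempty;
  \<open>s\<close> is its minimum. A nonpositive value before \<open>s\<close> would force a smaller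
  zero.\<close>

lemma first_zero:
  fixes f :: "real \<Rightarrow> real"
  assumes "a \<le> b" and cont: "continuous_on {a..b} f" and "0 < f a" "f b \<le> 0"
  obtains s where "a < s" "s \<le> b" "f s = 0" "\<And>x. a \<le> x \<Longrightarrow> x < s \<Longrightarrow> 0 < f x"
proof -
  define S where "S = {x\<in>{a..b}. f x = 0}"
  have "compact S"
    using continuous_closed_preimage_constant[OF cont, of 0] compact_Int_closed[of "{a..b}" S]
    by (simp add: S_def Int_def vimage_def conj_commute cong: conj_cong)
  moreover have "S \<noteq> {}"
    using IVT2'[of f b 0 a] assms by (auto simp: S_def)
  ultimately obtain s where s: "s \<in> S" "\<And>x. x \<in> S \<Longrightarrow> s \<le> x"
    using compact_attains_inf[of S] by blast
  have "0 < f x" if "a \<le> x" "x < s" for x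
  proof (rule ccontr)
    assume "\<not> 0 < f x"
    moreover have "continuous_on {a..x} f"
      using that s(1) by (intro continuous_on_subset[OF cont]) (auto simp: S_def)
    ultimately obtain y where "a \<le> y" "y \<le> x" "f y = 0"
      using IVT2'[of f x 0 a] assms(3) \<open>a \<le> x\<close> by auto
    with s(2)[of y] that s(1) show False
      by (auto simp: S_def)
  qed
  moreover have "a \<noteq> s"
    using s(1) assms(3) by (auto simp: S_def)
  ultimately show thesis
    using that[of s] s(1) by (auto simp: S_def)
qed

theorem theorem5p6:
  fixes B C \<epsilon> M :: real and u u' u'' :: "real \<Rightarrow> real"
  assumes B: "B > 0"
    and C: "- 1 \<le> C" "C < 1"
    and eps: "\<epsilon> \<le> C"
    and M: "M = (1 / 2 * (1 - C) * B) powr (1 / (1 - \<epsilon>))"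
    and deriv1: "\<forall>t\<in>{0..<1}. (u has_real_derivative u' t) (at t within {0..<1})"
    and deriv2: "\<forall>t\<in>{0..<1}. (u' has_real_derivative u'' t) (at t within {0..<1})"
    and cont2: "continuous_on {0..<1} u''"
    and ineq: "\<forall>t\<in>{0<..<1}. u t * u'' t \<ge> B * \<bar>u t\<bar> powr (1 + \<epsilon>) + C * (u' t)\<^sup>2"
    and init: "u 0 > 0" "u' 0 \<ge> 0"
  shows "M > 0 \<and> (SUP y\<in>{0..<1}. ereal (u y)) > ereal M"
proof (rule conjI)
  have base: "0 < 1 / 2 * (1 - C) * B"
    using B C by simp
  then show "M > 0"
    unfolding M by (metis powr_gt_zero less_irrefl)
  show "(SUP y\<in>{0..<1}. ereal (u y)) > ereal M"
  proof (rule ccontr)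
    assume "\<not> (SUP y\<in>{0..<1}. ereal (u y)) > ereal M"
    then have le_M: "u y \<le> M" if "0 \<le> y" "y < 1" for y
      using that by (auto simp: not_less SUP_le_iff)
    have interior: "at x within {0..<1} = at x" if "0 < x" "x < 1" for x :: real
      using that by (intro at_within_interior) simp
    have u': "(u has_real_derivative u' x) (at x)" if "0 < x" "x < 1" for x
      using bspec[OF deriv1, of x] interior[OF that] that by simp
    have u'': "(u' has_real_derivative u'' x) (at x)" if "0 < x" "x < 1" for x
      using bspec[OF deriv2, of x] interior[OF that] that by simp
    have cont_u: "continuous_on {0..<1} u" and cont_u': "continuous_on {0..<1} u'"
      using deriv1 deriv2 by (auto intro!: DERIV_continuous_on)
    have bound:
      "u 0 powr (1 - C) + (1 - C) * B * M powr (\<epsilon> - C) * t\<^sup>2 / 2 \<le> u t powr (1 - C)"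
      if "0 \<le> t" "t < 1" "\<And>x. 0 \<le> x \<Longrightarrow> x \<le> t \<Longrightarrow> 0 < u x" for t
      using that B C eps init ineq
      by (intro powr_quadratic_lower_bound[where u' = u' and u'' = u''] u' u'' le_M
          continuous_on_subset[OF cont_u] continuous_on_subset[OF cont_u']) auto
    \<comment> \<open>At a first zero \<open>s\<close> the bound is available only to the left of
      \<open>s\<close>. There it keeps \<open>u\<close> at least \<open>u 0\<close>, and continuity
      carries this to \<open>s\<close>, contradicting \<open>u s = 0\<close>.\<close>
    have pos: "0 < u t" if t: "0 \<le> t" "t < 1" for t
    proof (rule ccontr)
      assume "\<not> 0 < u t"
      moreover have "continuous_on {0..t} u"
        using t by (intro continuous_on_subset[OF cont_u]) auto
      ultimately obtain s where s: "0 < s" "s \<le> t" "u s = 0"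
        and before: "\<And>x. 0 \<le> x \<Longrightarrow> x < s \<Longrightarrow> 0 < u x"
        using first_zero[of 0 t u] t init(1) by (metis not_less)
      have ge: "u 0 \<le> u x" if "0 \<le> x" "x < s" for x
      proof -
        have "0 \<le> (1 - C) * B * M powr (\<epsilon> - C) * x\<^sup>2 / 2"
          using B C by simp
        with bound[of x] before that s t have "u 0 powr (1 - C) \<le> u x powr (1 - C)"
          by fastforce
        then show ?thesis
          using before[OF that] C powr_less_mono2[of "1 - C" "u x" "u 0"] by force
      qed
      have "(u \<longlongrightarrow> u s) (at_left s)"
        using DERIV_isCont[OF u'[of s]] s t
        by (simp add: isCont_def filterlim_at_split)
      moreover have "eventually (\<lambda>x. u 0 \<le> u x) (at_left s)"
        using eventually_at_left_real[OF s(1)] by eventually_elim (auto intro: ge)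
      ultimately have "u 0 \<le> u s"
        by (intro tendsto_lowerbound) auto
      with s init(1) show False by simp
    qed
    \<comment> \<open>Here the value of \<open>M\<close> enters: it makes the coefficient of
      \<open>t\<^sup>2\<close> exactly \<open>M powr (1 - C)\<close>, the upper bound for
      \<open>u t powr (1 - C)\<close>.\<close>
    have "(1 - C) * B = 2 * M powr (1 - \<epsilon>)"
      using base C eps by (simp add: M powr_powr)
    then have const: "(1 - C) * B * M powr (\<epsilon> - C) / 2 = M powr (1 - C)"
      using powr_add[of M "1 - \<epsilon>" "\<epsilon> - C"] by simp
    have gap: "u 0 powr (1 - C) + M powr (1 - C) * t\<^sup>2 \<le> M powr (1 - C)" if "0 \<le> t" "t < 1" for t
    proof -
      have "u 0 powr (1 - C) + M powr (1 - C) * t\<^sup>2 \<le> u t powr (1 - C)"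
        using bound[of t] pos that by (simp flip: const)
      also have "\<dots> \<le> M powr (1 - C)"
        using C pos[OF that] le_M[OF that] by (intro powr_mono2) auto
      finally show ?thesis .
    qed
    \<comment> \<open>The limit preserves only the weak inequality; the contradiction comes from the
      remaining term \<open>u 0 powr (1 - C)\<close>, which is strictly positive.\<close>
    have "((\<lambda>t. u 0 powr (1 - C) + M powr (1 - C) * t\<^sup>2) \<longlongrightarrow>
        u 0 powr (1 - C) + M powr (1 - C) * 1\<^sup>2) (at_left 1)"
      by (intro tendsto_intros)
    moreover have "eventually (\<lambda>t. u 0 powr (1 - C) + M powr (1 - C) * t\<^sup>2 \<le> M powr (1 - C))
        (at_left 1)"
      using eventually_at_left_real[OF zero_less_one] by eventually_elim (auto intro: gap)
    ultimately have "u 0 powr (1 - C) + M powr (1 - C) * 1\<^sup>2 \<le> M powr (1 - C)"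
      by (intro tendsto_upperbound) auto
    then show False
      using init(1) by (simp add: not_le)
  qed
qed

end
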